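(* Let $G=(V,E)$ be a graph on $n$ vertices and let $k,s$ be integers with $1<s<k$. For integers $N$, $K\ge 0$ put $$h(N,K,s)=\sum_{j=0}^{\lfloor K/(s+1)\rfloor}(-1)^j\binom{N}{j}\sum_{\substack{t_1,t_2,\ldots,t_j\ge s+1\\ t_1+t_2+\cdots+t_j\le K}}\binom{K}{t_1,\ldots,t_j}(N-j)^{K-t_1-\cdots-t_j},$$ where the inner sum is over ordered $j$-tuples of integers, the $j=0$ term is understood to be $N^K$, and $h(N,0,s)=1$. Then the order and the size of the supertoken graph $F_{k\times 1}^s(G)$ are, respectively, $$|V(F_{k\times 1}^s(G))|=h(n,k,s)$$ and $$|E(F_{k\times 1}^s(G))|=|E|\sum_{\substack{0\le r_u,r_v\le s-1\\ r_u+r_v\le k-1}}(r_u+1)\binom{k}{r_u+1,\,r_v}\,h(n-2,\,k-r_u-r_v-1,\,s),$$ where the sum is over pairs of integers $(r_u,r_v)$.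
   Context: Graphs are finite, simple and undirected. For a graph $G=(V,E)$ and integers $1\le s\le k$, the supertoken graph $F_{k\times 1}^s(G)$ (with $k$ pairwise different tokens) has as vertices the ordered $k$-tuples $(\alpha_1,\ldots,\alpha_k)\in V^k$ in which every vertex of $G$ occurs at most $s$ times ($\alpha_i$ is the position of token $i$). Two such tuples are adjacent if they differ in exactly one coordinate $i$, and the two entries in coordinate $i$ are adjacent in $G$. For nonnegative integers $t_1,\ldots,t_j$ with $t_1+\cdots+t_j\le K$, set $\binom{K}{t_1,\ldots,t_j}=\dfrac{K!}{t_1!\cdots t_j!\,(K-t_1-\cdots-t_j)!}$. The convention $0^0=1$ is used. *)

theory Defs
  imports Complex_Main
begin

record 'a graph =
  verts :: "'a set"
  edges :: "'a set set"

definition simple_graph :: "'a graph \<Rightarrow> bool" where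
  "simple_graph G \<longleftrightarrow>
     finite (verts G) \<and> (\<forall>e\<in>edges G. e \<subseteq> verts G \<and> card e = 2)"

text \<open>A tuple of token positions is a list \<open>\<alpha>\<close>, with \<open>\<alpha> ! i\<close> the position of token \<open>i\<close>
  (tokens are numbered \<open>0, \<dots>, k - 1\<close>).\<close>

definition token_configs :: "nat \<Rightarrow> nat \<Rightarrow> 'a graph \<Rightarrow> 'a list set" where
  "token_configs k s G =
     {\<alpha>. length \<alpha> = k \<and> set \<alpha> \<subseteq> verts G \<and> (\<forall>v\<in>verts G. count_list \<alpha> v \<le> s)}"

definition token_move :: "nat \<Rightarrow> 'a graph \<Rightarrow> 'a list \<Rightarrow> 'a list \<Rightarrow> bool" where
  "token_move k G \<alpha> \<beta> \<longleftrightarrow>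
     (\<exists>i<k. {j. j < k \<and> \<alpha> ! j \<noteq> \<beta> ! j} = {i} \<and> {\<alpha> ! i, \<beta> ! i} \<in> edges G)"

definition supertoken_graph :: "nat \<Rightarrow> nat \<Rightarrow> 'a graph \<Rightarrow> 'a list graph" where
  "supertoken_graph k s G =
     \<lparr>verts = token_configs k s G,
      edges = {{\<alpha>, \<beta>} | \<alpha> \<beta>. \<alpha> \<in> token_configs k s G \<and> \<beta> \<in> token_configs k s G
                              \<and> token_move k G \<alpha> \<beta>}\<rparr>"

lemma simple_graph_supertoken_graph:
  assumes "simple_graph G"
  shows "simple_graph (supertoken_graph k s G)"
proof -
  have "finite {\<alpha>. set \<alpha> \<subseteq> verts G \<and> length \<alpha> = k}"
    using assms by (intro finite_lists_length_eq) (simp add: simple_graph_def)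
  then have "finite (token_configs k s G)"
    by (rule rev_finite_subset) (auto simp: token_configs_def)
  moreover have "\<alpha> \<noteq> \<beta>" if "token_move k G \<alpha> \<beta>" for \<alpha> \<beta>
    using that by (auto simp: token_move_def)
  ultimately show ?thesis
    by (force simp: simple_graph_def supertoken_graph_def card_insert_if)
qed

text \<open>The list \<open>ts\<close> need not sum to \<open>K\<close>; the remaining \<open>K - sum_list ts\<close> objects form a further
  block. Only meaningful for \<open>sum_list ts \<le> K\<close>.\<close>

definition multinomial :: "nat \<Rightarrow> nat list \<Rightarrow> real" where
  "multinomial K ts = fact K / (prod_list (map fact ts) * fact (K - sum_list ts))"

text \<open>For \<open>j = 0\<close> the inner sum has the empty list as its only index, giving \<open>N ^ K\<close>.
  The difference \<open>N - j\<close> is taken in the reals because \<open>j\<close> may exceed \<open>N\<close>.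
  Since \<open>N\<close> is a natural number, the argument \<open>n - 2\<close> in the count of the edges is truncated
  for \<open>n < 2\<close>; there the graph has no edges and the term is multiplied by 0.\<close>

definition h_count :: "nat \<Rightarrow> nat \<Rightarrow> nat \<Rightarrow> real" where
  "h_count N K s =
     (\<Sum>j = 0..K div (s + 1). (- 1) ^ j * real (N choose j) *
        (\<Sum>ts | length ts = j \<and> (\<forall>t\<in>set ts. s + 1 \<le> t) \<and> sum_list ts \<le> K.
           multinomial K ts * (real N - real j) ^ (K - sum_list ts)))"

lemma h_count_0: "h_count N 0 s = 1"
proof -
  have "{ts :: nat list. ts = [] \<and> (\<forall>t\<in>set ts. s + 1 \<le> t) \<and> sum_list ts = 0} = {[]}"
    by auto
  then show ?thesis
    by (simp add: h_count_def multinomial_def)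
qed

end

theory Submission
  imports Defs "HOL-Computational_Algebra.Formal_Power_Series"
begin

text \<open>Let \<open>E\<^sub>s = \<Sum>t\<le>s. x ^ t / t!\<close>. Placing \<open>K\<close> distinct tokens on \<open>N\<close> vertices, at most \<open>s\<close> on
  each, can be done in \<open>K! [x^K] E\<^sub>s ^ N\<close> ways. Writing \<open>E\<^sub>s = exp x - R\<close> with \<open>R\<close> the tail of the
  exponential series, the binomial theorem turns this number into \<open>h(N, K, s)\<close>. An edge of the
  supertoken graph consists of a moving token, an edge \<open>uv\<close> of the graph and a placement of the other
  \<open>k - 1\<close> tokens with at most \<open>s - 1\<close> of them on each of \<open>u\<close> and \<open>v\<close>, which gives
  \<open>k (k - 1)! [x^(k-1)] E\<^sub>s\<^sub>-\<^sub>1 ^ 2 * E\<^sub>s ^ (n - 2)\<close> for every edge; the sum over \<open>r\<^sub>u, r\<^sub>v\<close> is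
  the expansion of this coefficient. Ordered pairs of adjacent vertices (darts) are counted instead
  of edges so that no orientations have to be chosen.\<close>

unbundle fps_syntax

section \<open>Exponential generating functions of lists with weighted letters\<close>

lemma fps_deriv_prod:
  fixes F :: "'a \<Rightarrow> 'b::comm_ring_1 fps"
  assumes "finite A"
  shows "fps_deriv (\<Prod>v\<in>A. F v) = (\<Sum>x\<in>A. \<Prod>v\<in>A. if v = x then fps_deriv (F v) else F v)"
  using assms
proof (induction A rule: finite_induct)
  case empty
  then show ?case by simp
next
  case (insert y A)
  have "(\<Prod>v\<in>A. if v = y then fps_deriv (F v) else F v) = (\<Prod>v\<in>A. F v)"
    using insert.hyps by (intro prod.cong) auto
  moreover have "(\<Prod>v\<in>insert y A. if v = x then fps_deriv (F v) else F v)
      = F y * (\<Prod>v\<in>A. if v = x then fps_deriv (F v) else F v)" if "x \<in> A" for x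
    using insert.hyps that by auto
  ultimately show ?case
    using insert by (simp add: sum_distrib_left add.commute)
qed

text \<open>Prepending \<open>x\<close> to a list shifts the weights of \<open>x\<close>, and shifting the weights differentiates
  the exponential generating function of \<open>x\<close>; so the induction step is the product rule.\<close>

lemma sum_lists_weights:
  fixes f :: "'a \<Rightarrow> nat \<Rightarrow> 'b::field_char_0"
  assumes "finite A"
  shows "(\<Sum>xs | length xs = K \<and> set xs \<subseteq> A. \<Prod>v\<in>A. f v (count_list xs v))
    = fact K * (\<Prod>v\<in>A. Abs_fps (\<lambda>t. f v t / fact t)) $ K"
proof (induction K arbitrary: f)
  case 0
  have "{xs. length xs = 0 \<and> set xs \<subseteq> A} = {[]}"
    by auto
  moreover have "(\<Prod>v\<in>A. Abs_fps (\<lambda>t. f v t / fact t)) $ 0 = (\<Prod>v\<in>A. f v 0)"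
    using assms by (induction A rule: finite_induct) auto
  ultimately show ?case
    by simp
next
  case (Suc K)
  define L where "L = {xs. length xs = K \<and> set xs \<subseteq> A}"
  define E where "E f v = Abs_fps (\<lambda>t. f v t / fact t)" for f :: "'a \<Rightarrow> nat \<Rightarrow> 'b" and v
  define shift where "shift x v = (if v = x then f v \<circ> Suc else f v)" for x v
  have deriv_E: "(if v = x then fps_deriv (E f v) else E f v) = E (shift x) v" for x v
    by (auto simp: fps_eq_iff E_def shift_def simp del: of_nat_Suc)
  have count_Cons: "f v (count_list (x # xs) v) = shift x v (count_list xs v)" for x xs v
    by (simp add: shift_def)
  have "{xs. length xs = Suc K \<and> set xs \<subseteq> A} = (\<lambda>(x, xs). x # xs) ` (A \<times> L)"
    unfolding L_def by (force simp: length_Suc_conv)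
  then have "(\<Sum>xs | length xs = Suc K \<and> set xs \<subseteq> A. \<Prod>v\<in>A. f v (count_list xs v))
    = (\<Sum>(x, xs)\<in>A \<times> L. \<Prod>v\<in>A. f v (count_list (x # xs) v))"
    by (simp add: sum.reindex inj_on_def case_prod_beta del: count_list.simps)
  also have "\<dots> = (\<Sum>x\<in>A. \<Sum>xs\<in>L. \<Prod>v\<in>A. shift x v (count_list xs v))"
    by (simp only: sum.cartesian_product count_Cons)
  also have "\<dots> = (\<Sum>x\<in>A. fact K * (\<Prod>v\<in>A. E (shift x) v) $ K)"
    unfolding L_def Suc.IH E_def ..
  also have "\<dots> = fact K * fps_deriv (\<Prod>v\<in>A. E f v) $ K"
    unfolding fps_deriv_prod[OF assms] deriv_E fps_sum_nth sum_distrib_left ..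
  also have "\<dots> = fact (Suc K) * (\<Prod>v\<in>A. E f v) $ Suc K"
    by simp
  finally show ?case
    unfolding E_def .
qed

section \<open>Capped placements, truncated exponentials and \<open>h_count\<close>\<close>

definition fps_exp_trunc :: "nat \<Rightarrow> real fps" where
  "fps_exp_trunc s = Abs_fps (\<lambda>t. if t \<le> s then 1 / fact t else 0)"

text \<open>Weights 1 and 0, according to whether a cap is respected, turn the weighted sum into a
  count. The cap may vary with the vertex because, once a token moving along an edge is set aside,
  the two ends of that edge have room for one token less.\<close>

lemma card_lists_capped:
  fixes c :: "'a \<Rightarrow> nat"
  assumes "finite A"
  shows "real (card {xs. length xs = K \<and> set xs \<subseteq> A \<and> (\<forall>v\<in>A. count_list xs v \<le> c v)})
    = fact K * (\<Prod>v\<in>A. fps_exp_trunc (c v)) $ K"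
proof -
  define f where "f v t = (if t \<le> c v then 1 else 0 :: real)" for v t
  let ?L = "{xs. length xs = K \<and> set xs \<subseteq> A}"
  have fin: "finite ?L"
    using finite_lists_length_eq[OF assms, of K] by (simp add: conj_commute)
  have "(\<Prod>v\<in>A. f v (count_list xs v)) = (if \<forall>v\<in>A. count_list xs v \<le> c v then 1 else 0)" for xs
    using assms by (auto simp: f_def intro: prod_zero)
  then have "(\<Sum>xs\<in>?L. \<Prod>v\<in>A. f v (count_list xs v))
      = real (card {xs \<in> ?L. \<forall>v\<in>A. count_list xs v \<le> c v})"
    using fin by (simp add: sum.If_cases Int_def)
  moreover have "Abs_fps (\<lambda>t. f v t / fact t) = fps_exp_trunc (c v)" for v
    by (auto simp: fps_exp_trunc_def fps_eq_iff f_def)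
  ultimately show ?thesis
    using sum_lists_weights[OF assms, where f = f and K = K] by (simp add: conj_assoc)
qed

text \<open>Expanding the product, \<open>ts\<close> records the exponent picked from each of the
  \<open>j\<close> factors \<open>F\<close>, and \<open>H\<close> supplies the rest. It serves
  twice: for powers of the exponential tail with \<open>T\<close> equal to \<open>{s + 1..}\<close>,
  and for the square of a truncated exponential with \<open>T\<close> equal to
  \<open>{..s - 1}\<close>.\<close>

lemma fps_power_mult_nth:
  fixes F H :: "'a::comm_ring_1 fps"
  assumes "\<And>t. t \<notin> T \<Longrightarrow> F $ t = 0"
  shows "(F ^ j * H) $ K = (\<Sum>ts | length ts = j \<and> set ts \<subseteq> T \<and> sum_list ts \<le> K.
    prod_list (map (fps_nth F) ts) * H $ (K - sum_list ts))"
proof (induction j arbitrary: K)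
  case 0
  have "{ts :: nat list. length ts = 0 \<and> set ts \<subseteq> T \<and> sum_list ts \<le> K} = {[]}"
    by auto
  then show ?case by simp
next
  case (Suc j)
  define S where
    "S m = {ts. length ts = j \<and> set ts \<subseteq> T \<and> sum_list ts \<le> m}" for m :: nat
  \<comment> \<open>\<open>T\<close> may be infinite; the bound on the sum is what bounds the
    entries.\<close>
  have fin: "finite (S m)" for m
  proof (rule finite_subset)
    show "S m \<subseteq> {ts. set ts \<subseteq> {..m} \<and> length ts = j}"
      unfolding S_def using member_le_sum_list order_trans by fastforce
  qed (simp add: finite_lists_length_eq)
  have image: "{ts. length ts = Suc j \<and> set ts \<subseteq> T \<and> sum_list ts \<le> K}
      = (\<lambda>(t, ts). t # ts) ` (SIGMA t:T \<inter> {..K}. S (K - t))"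
    unfolding S_def by (force simp: length_Suc_conv image_iff)
  have "(F ^ Suc j * H) $ K = (\<Sum>t=0..K. F $ t * (F ^ j * H) $ (K - t))"
    by (simp add: fps_mult_nth[of F] mult.assoc)
  also have "\<dots> = (\<Sum>t\<in>T \<inter> {..K}. F $ t * (F ^ j * H) $ (K - t))"
    by (rule sum.mono_neutral_right) (auto, metis assms mult_zero_left)
  also have "\<dots> = (\<Sum>t\<in>T \<inter> {..K}. \<Sum>ts\<in>S (K - t).
      prod_list (map (fps_nth F) (t # ts)) * H $ (K - sum_list (t # ts)))"
    unfolding Suc.IH S_def by (simp add: sum_distrib_left mult.assoc)
  also have "\<dots> = (\<Sum>(t, ts)\<in>(SIGMA t:T \<inter> {..K}. S (K - t)).
      prod_list (map (fps_nth F) (t # ts)) * H $ (K - sum_list (t # ts)))"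
    by (rule sum.Sigma) (auto simp: fin)
  also have "\<dots> = (\<Sum>ts | length ts = Suc j \<and> set ts \<subseteq> T \<and> sum_list ts \<le> K.
      prod_list (map (fps_nth F) ts) * H $ (K - sum_list ts))"
    unfolding image by (subst sum.reindex) (auto simp: inj_on_def case_prod_beta)
  finally show ?case .
qed

text \<open>Up to the factor \<open>fact K\<close> the summands are those of \<open>h_count\<close>.
  The range of \<open>j\<close> is the one given by the binomial theorem.\<close>

lemma fps_exp_trunc_power_nth:
  "(fps_exp_trunc s ^ N) $ K = (\<Sum>j\<le>N. (-1) ^ j * real (N choose j) *
     (\<Sum>ts | length ts = j \<and> (\<forall>t\<in>set ts. s + 1 \<le> t) \<and> sum_list ts \<le> K.
        (real N - real j) ^ (K - sum_list ts)
          / (prod_list (map fact ts) * fact (K - sum_list ts))))"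
proof -
  define R :: "real fps" where "R = Abs_fps (\<lambda>t. if s + 1 \<le> t then 1 / fact t else 0)"
  have expand: "(R ^ j * fps_exp (real N - real j)) $ K =
      (\<Sum>ts | length ts = j \<and> (\<forall>t\<in>set ts. s + 1 \<le> t) \<and> sum_list ts \<le> K.
        (real N - real j) ^ (K - sum_list ts)
          / (prod_list (map fact ts) * fact (K - sum_list ts)))" for j
  proof -
    have R_map: "prod_list (map (fps_nth R) ts) = 1 / prod_list (map fact ts)"
      if "\<forall>t\<in>set ts. s + 1 \<le> t" for ts
      using that by (induction ts) (auto simp: R_def)
    have "R $ t = 0" if "t \<notin> {s + 1..}" for t
      using that by (auto simp: R_def)
    from fps_power_mult_nth[where F = R and T = "{s + 1..}", OF this] show ?thesis
      by (auto intro!: sum.cong simp: R_map subset_iff)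
  qed
  have "fps_exp_trunc s = - R + fps_exp 1"
    by (auto simp: fps_eq_iff fps_exp_trunc_def R_def)
  then have "fps_exp_trunc s ^ N
      = (\<Sum>j\<le>N. of_nat (N choose j) * (- R) ^ j * fps_exp 1 ^ (N - j))"
    by (simp only: binomial_ring)
  \<comment> \<open>For \<open>j\<close> at most \<open>N\<close> the truncated difference agrees
    with the real one, and the power of \<open>fps_exp 1\<close> is again an exponential series. At
    \<open>j = N\<close> it is the constant 1, in line with the convention that 0 to the power 0 is
    1.\<close>
  also have "\<dots> = (\<Sum>j\<le>N. fps_const ((-1) ^ j * real (N choose j)) * (R ^ j * fps_exp (real N - real j)))"
  proof (rule sum.cong)
    fix j
    assume "j \<in> {..N}"
    have "fps_const ((-1 :: real) ^ j * real (N choose j)) = (-1) ^ j * of_nat (N choose j)"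
      by (cases "even j") (simp_all add: fps_of_nat flip: fps_const_neg)
    with \<open>j \<in> {..N}\<close> show "of_nat (N choose j) * (- R) ^ j * fps_exp 1 ^ (N - j)
      = fps_const ((-1) ^ j * real (N choose j)) * (R ^ j * fps_exp (real N - real j))"
      by (simp add: fps_exp_power_mult power_minus[of R] of_nat_diff mult_ac)
  qed simp
  finally show ?thesis
    by (simp add: fps_sum_nth expand)
qed

text \<open>The two ranges of \<open>j\<close> are reconciled inside their union: beyond
  \<open>K div (s + 1)\<close> there is no list \<open>ts\<close>, since \<open>j\<close> entries of
  size at least \<open>s + 1\<close> exceed \<open>K\<close>, and beyond \<open>N\<close> the
  binomial coefficient vanishes.\<close>

lemma h_count_eq_coeff: "h_count N K s = fact K * (fps_exp_trunc s ^ N) $ K"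
proof -
  define X where "X j = {ts. length ts = j \<and> (\<forall>t\<in>set ts. s + 1 \<le> t) \<and> sum_list ts \<le> K}" for j
  define g where "g j = (-1) ^ j * real (N choose j) *
    (\<Sum>ts\<in>X j. multinomial K ts * (real N - real j) ^ (K - sum_list ts))" for j
  have g_0: "g j = 0" if "K div (s + 1) < j" for j
  proof -
    have "length ts * (s + 1) \<le> sum_list ts" if "\<forall>t\<in>set ts. s + 1 \<le> t" for ts
      using that by (induction ts) auto
    moreover have "K < j * (s + 1)"
      using that by (simp add: div_less_iff_less_mult)
    ultimately have "X j = {}"
      unfolding X_def by fastforce
    then show ?thesis
      by (simp add: g_def)
  qed
  have "h_count N K s = (\<Sum>j = 0..K div (s + 1). g j)"
    by (simp add: h_count_def g_def X_def)
  also have "\<dots> = (\<Sum>j \<le> max N (K div (s + 1)). g j)"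
    by (rule sum.mono_neutral_left) (auto intro: g_0)
  also have "\<dots> = (\<Sum>j\<le>N. g j)"
    by (rule sum.mono_neutral_right) (auto simp: g_def)
  also have "\<dots> = fact K * (fps_exp_trunc s ^ N) $ K"
    unfolding fps_exp_trunc_power_nth sum_distrib_left g_def X_def multinomial_def
    by (intro sum.cong refl) (simp add: sum_distrib_left mult_ac)
  finally show ?thesis .
qed

section \<open>Counting edges through darts\<close>

lemma card_unordered_pairs:
  assumes "finite D" and "sym D" and "irrefl D"
  shows "card D = 2 * card {{a, b} | a b. (a, b) \<in> D}"
proof -
  let ?g = "\<lambda>(a, b). {a, b}"
  have fibre: "card {p \<in> D. ?g p = e} = 2" if e: "e \<in> ?g ` D" for e
  proof -
    obtain a b where "(a, b) \<in> D" "e = {a, b}"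
      using e by auto
    moreover from this have "(b, a) \<in> D" "a \<noteq> b"
      using assms by (auto dest: symD simp: irrefl_def)
    ultimately have "{p \<in> D. ?g p = e} = {(a, b), (b, a)}"
      by (auto simp: doubleton_eq_iff)
    then show ?thesis
      using \<open>a \<noteq> b\<close> by simp
  qed
  have "card D = (\<Sum>e\<in>?g ` D. card {p \<in> D. ?g p = e})"
    using sum.image_gen[OF assms(1), of "\<lambda>_. 1 :: nat" ?g] by simp
  also have "\<dots> = 2 * card (?g ` D)"
    by (simp add: fibre del: split_paired_All)
  also have "?g ` D = {{a, b} | a b. (a, b) \<in> D}"
    by (auto simp: image_iff split: prod.splits)
  finally show ?thesis .
qed

definition darts :: "'a graph \<Rightarrow> ('a \<times> 'a) set" where
  "darts G = {(u, v). {u, v} \<in> edges G}"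

lemma dartsD:
  assumes "simple_graph G" and "(u, v) \<in> darts G"
  shows "u \<in> verts G" "v \<in> verts G" "u \<noteq> v"
  using assms by (auto simp: simple_graph_def darts_def)

lemma card_darts:
  assumes "simple_graph G"
  shows "finite (darts G)" and "card (darts G) = 2 * card (edges G)"
proof -
  have "darts G \<subseteq> verts G \<times> verts G"
    using dartsD[OF assms] by auto
  then show fin: "finite (darts G)"
    using assms finite_subset by (fastforce simp: simple_graph_def)
  have "{{a, b} | a b. (a, b) \<in> darts G} = edges G"
    using assms by (fastforce simp: simple_graph_def darts_def card_2_iff)
  moreover have "sym (darts G)"
    by (auto simp: sym_def darts_def insert_commute)
  moreover have "irrefl (darts G)"
    using dartsD(3)[OF assms] by (auto simp: irrefl_def)
  ultimately show "card (darts G) = 2 * card (edges G)"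
    using card_unordered_pairs[OF fin] by simp
qed

section \<open>Moves of one token among the others\<close>

definition insert_nth :: "nat \<Rightarrow> 'a \<Rightarrow> 'a list \<Rightarrow> 'a list" where
  "insert_nth i x xs = take i xs @ x # drop i xs"

lemma insert_nth_simps [simp]:
  "length (insert_nth i x xs) = Suc (length xs)"
  "set (insert_nth i x xs) = insert x (set xs)"
  "count_list (insert_nth i x xs) y = count_list xs y + (if x = y then 1 else 0)"
  "i \<le> length xs \<Longrightarrow> insert_nth i x xs ! i = x"
proof -
  have "set xs = set (take i xs) \<union> set (drop i xs)"
    by (metis append_take_drop_id set_append)
  then show "set (insert_nth i x xs) = insert x (set xs)"
    by (auto simp: insert_nth_def)
  have "count_list xs y = count_list (take i xs) y + count_list (drop i xs) y"
    by (metis append_take_drop_id count_list_append)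
  then show "count_list (insert_nth i x xs) y = count_list xs y + (if x = y then 1 else 0)"
    by (auto simp: insert_nth_def)
qed (auto simp: insert_nth_def nth_append)

lemma insert_nth_nth_eq:
  assumes "j \<noteq> i" and "j \<le> length xs" and "i \<le> length xs"
  shows "insert_nth i x xs ! j = insert_nth i y xs ! j"
  using assms by (auto simp: insert_nth_def nth_append nth_Cons')

lemma insert_nth_inject:
  assumes "insert_nth i x xs = insert_nth i y ys" and "length xs = length ys"
  shows "xs = ys"
  using assms by (metis append_eq_append_conv append_take_drop_id insert_nth_def length_take
      list.inject)

lemma insert_nth_remove:
  assumes "i < length xs"
  shows "insert_nth i (xs ! i) (take i xs @ drop (Suc i) xs) = xs"
  using assms by (simp add: insert_nth_def id_take_nth_drop[symmetric])

text \<open>A move is the token \<open>i\<close> that moves, the dart it moves along, and the positions \<open>xs\<close> of the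
  other tokens, which leave room for one more token at both ends of the dart.\<close>

lemma bij_betw_token_moves:
  assumes G: "simple_graph G" and "0 < s"
  shows "bij_betw (\<lambda>(i, (u, v), xs). (insert_nth i u xs, insert_nth i v xs))
    ({..<Suc m} \<times> (SIGMA (u, v):darts G. {xs. length xs = m \<and> set xs \<subseteq> verts G \<and>
       (\<forall>w\<in>verts G. count_list xs w \<le> (if w \<in> {u, v} then s - 1 else s))}))
    (darts (supertoken_graph (Suc m) s G))"
    (is "bij_betw ?f ({..<Suc m} \<times> Sigma _ ?L) ?D")
proof -
  have diff: "{j. j < Suc m \<and> insert_nth i u xs ! j \<noteq> insert_nth i v xs ! j} = {i}"
    if "i < Suc m" "length xs = m" "u \<noteq> v" for i u v and xs :: "'a list"
    using that insert_nth_nth_eq[of _ i xs u v] by fastforce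
  have D_iff: "(\<alpha>, \<beta>) \<in> ?D \<longleftrightarrow> \<alpha> \<in> token_configs (Suc m) s G \<and>
      \<beta> \<in> token_configs (Suc m) s G \<and> token_move (Suc m) G \<alpha> \<beta>" for \<alpha> \<beta>
  proof -
    have "token_move (Suc m) G \<beta> \<alpha> = token_move (Suc m) G \<alpha> \<beta>" for \<alpha> \<beta>
      by (simp add: token_move_def insert_commute eq_commute)
    then show ?thesis
      by (auto simp: darts_def supertoken_graph_def doubleton_eq_iff)
  qed
  \<comment> \<open>Positivity of \<open>s\<close> matters here: for \<open>s = 0\<close> the
    truncated cap \<open>s - 1\<close> would be 0 and would wrongly leave room for one more
    token.\<close>
  have caps: "insert_nth i u xs \<in> token_configs (Suc m) s G \<and>
      insert_nth i v xs \<in> token_configs (Suc m) s G \<longleftrightarrow> xs \<in> ?L (u, v)"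
    if "(u, v) \<in> darts G" for i u v xs
    using dartsD[OF G that] \<open>0 < s\<close> by (auto simp: token_configs_def)
  show ?thesis
    unfolding bij_betw_def
  proof
    show "inj_on ?f ({..<Suc m} \<times> Sigma (darts G) ?L)"
    proof (rule inj_onI)
      fix p q
      assume "p \<in> {..<Suc m} \<times> Sigma (darts G) ?L" "q \<in> {..<Suc m} \<times> Sigma (darts G) ?L"
        and "?f p = ?f q"
      then obtain i u v xs j u' v' ys where p: "p = (i, (u, v), xs)" and q: "q = (j, (u', v'), ys)"
        and i: "i < Suc m" and j: "j < Suc m"
        and d: "(u, v) \<in> darts G" "(u', v') \<in> darts G"
        and xs: "xs \<in> ?L (u, v)" and ys: "ys \<in> ?L (u', v')"
        and eq: "insert_nth i u xs = insert_nth j u' ys" "insert_nth i v xs = insert_nth j v' ys"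
        by (cases p, cases q) auto
      have len: "length xs = m" "length ys = m"
        using xs ys by auto
      \<comment> \<open>The moving token is recovered as the only place where the two tuples differ.
        Their entries there are the ends of the dart, and deleting that place leaves the other
        tokens.\<close>
      have "{i} = {j}"
        using diff[OF i len(1) dartsD(3)[OF G d(1)]] diff[OF j len(2) dartsD(3)[OF G d(2)]] eq
        by simp
      then have ij: "i = j"
        by simp
      moreover have "u = u'" "v = v'"
        using eq i len unfolding ij by (metis insert_nth_simps(4) less_Suc_eq_le)+
      moreover have "xs = ys"
        using eq(1) len unfolding ij by (metis insert_nth_inject)
      ultimately show "p = q"
        by (simp add: p q)
    qed
    show "?f ` ({..<Suc m} \<times> Sigma (darts G) ?L) = ?D"
    proof (intro equalityI subsetI)
      fix p
      assume "p \<in> ?f ` ({..<Suc m} \<times> Sigma (darts G) ?L)"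
      then obtain i u v xs where p: "p = (insert_nth i u xs, insert_nth i v xs)"
        and i: "i < Suc m" and d: "(u, v) \<in> darts G" and xs: "xs \<in> ?L (u, v)"
        by auto
      have len: "length xs = m"
        using xs by simp
      have "token_move (Suc m) G (insert_nth i u xs) (insert_nth i v xs)"
        unfolding token_move_def using diff[OF i len dartsD(3)[OF G d]] i d len
        by (intro exI[of _ i]) (auto simp: darts_def)
      then show "p \<in> ?D"
        unfolding p D_iff using caps[OF d] xs by blast
    next
      fix p
      assume "p \<in> ?D"
      then obtain \<alpha> \<beta> where p: "p = (\<alpha>, \<beta>)"
        and conf: "\<alpha> \<in> token_configs (Suc m) s G" "\<beta> \<in> token_configs (Suc m) s G"
        and "token_move (Suc m) G \<alpha> \<beta>"
        using D_iff by (cases p) auto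
      then obtain i where i: "i < Suc m" and d: "(\<alpha> ! i, \<beta> ! i) \<in> darts G"
        and agree: "\<And>j. j < Suc m \<Longrightarrow> j \<noteq> i \<Longrightarrow> \<alpha> ! j = \<beta> ! j"
        unfolding token_move_def darts_def by auto
      have len: "length \<alpha> = Suc m" "length \<beta> = Suc m"
        using conf by (auto simp: token_configs_def)
      define xs where "xs = take i \<alpha> @ drop (Suc i) \<alpha>"
      \<comment> \<open>Deleting the moving token from either tuple gives the same list, as the
        tuples agree elsewhere.\<close>
      have "xs = take i \<beta> @ drop (Suc i) \<beta>"
        unfolding xs_def using agree i len by (intro arg_cong2[of _ _ _ _ append] nth_equalityI) auto
      then have eq: "insert_nth i (\<alpha> ! i) xs = \<alpha>" "insert_nth i (\<beta> ! i) xs = \<beta>"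
        using insert_nth_remove[of i] i len xs_def by metis+
      then have "xs \<in> ?L (\<alpha> ! i, \<beta> ! i)"
        using caps[OF d, of i xs] conf by simp
      then show "p \<in> ?f ` ({..<Suc m} \<times> Sigma (darts G) ?L)"
        using i d eq p by (intro image_eqI[of _ _ "(i, (\<alpha> ! i, \<beta> ! i), xs)"]) auto
    qed
  qed
qed

text \<open>Every dart of \<open>G\<close> admits \<open>Suc m\<close> moving tokens and
  \<open>fact m\<close> times the coefficient many placements of the others, whence
  \<open>fact (Suc m)\<close>. Darts are twice the edges in both graphs, so the factors 2
  cancel.\<close>

lemma card_edges_supertoken_graph:
  assumes G: "simple_graph G" and "0 < s"
  shows "real (card (edges (supertoken_graph (Suc m) s G))) = real (card (edges G)) *
    (fact (Suc m) * (fps_exp_trunc (s - 1) ^ 2 * fps_exp_trunc s ^ (card (verts G) - 2)) $ m)"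
    (is "_ = _ * (_ * ?c)")
proof -
  let ?L = "\<lambda>(u, v). {xs. length xs = m \<and> set xs \<subseteq> verts G \<and>
    (\<forall>w\<in>verts G. count_list xs w \<le> (if w \<in> {u, v} then s - 1 else s))}"
  have fin: "finite (verts G)"
    using G by (simp add: simple_graph_def)
  have fin_L: "finite (?L p)" for p
    by (rule finite_subset[OF _ finite_lists_length_eq[OF fin, of m]]) (auto split: prod.splits)
  have card_L: "real (card (?L p)) = fact m * ?c" if "p \<in> darts G" for p
  proof -
    obtain u v where p: "p = (u, v)"
      by (cases p)
    have uv: "{u, v} \<subseteq> verts G" "u \<noteq> v"
      using dartsD[OF G] that p by auto
    \<comment> \<open>Two distinct vertices have the lower cap, so the difference
      \<open>card (verts G) - 2\<close> is not truncated here.\<close>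
    have "(\<Prod>w\<in>verts G. fps_exp_trunc (if w \<in> {u, v} then s - 1 else s))
      = (\<Prod>w\<in>verts G - {u, v}. fps_exp_trunc s) * (\<Prod>w\<in>{u, v}. fps_exp_trunc (s - 1))"
      unfolding prod.subset_diff[OF uv(1) fin] by (intro arg_cong2[of _ _ _ _ times] prod.cong) auto
    also have "\<dots> = fps_exp_trunc (s - 1) ^ 2 * fps_exp_trunc s ^ (card (verts G) - 2)"
      using uv fin by (simp add: card_Diff_subset numeral_2_eq_2 mult_ac)
    finally show ?thesis
      using card_lists_capped[OF fin, of m "\<lambda>w. if w \<in> {u, v} then s - 1 else s"] p by simp
  qed
  have card_Sigma: "card (Sigma (darts G) ?L) = (\<Sum>p\<in>darts G. card (?L p))"
    by (rule card_SigmaI[OF card_darts(1)[OF G]]) (rule ballI, rule fin_L)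
  have "real (card (darts (supertoken_graph (Suc m) s G)))
      = real (card ({..<Suc m} \<times> Sigma (darts G) ?L))"
    using bij_betw_same_card[OF bij_betw_token_moves[OF assms]] by simp
  also have "\<dots> = real (Suc m) * (\<Sum>p\<in>darts G. real (card (?L p)))"
    by (simp only: card_cartesian_product card_lessThan card_Sigma of_nat_mult of_nat_sum)
  also have "(\<Sum>p\<in>darts G. real (card (?L p))) = (\<Sum>p\<in>darts G. fact m * ?c)"
    by (rule sum.cong[OF refl card_L])
  also have "real (Suc m) * \<dots> = 2 * (real (card (edges G)) * (fact (Suc m) * ?c))"
    by (simp add: card_darts(2)[OF G])
  finally show ?thesis
    using card_darts(2)[OF simple_graph_supertoken_graph[OF G]] by simp
qed

section \<open>Order and size of the supertoken graph\<close>

theorem proposition7p1: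
  fixes G :: "'a graph" and n k s :: nat
  assumes "simple_graph G"
    and "card (verts G) = n"
    and "1 < s" and "s < k"
  shows "real (card (verts (supertoken_graph k s G))) = h_count n k s
    \<and> real (card (edges (supertoken_graph k s G))) =
        real (card (edges G)) *
        (\<Sum>(r\<^sub>u, r\<^sub>v) | r\<^sub>u \<le> s - 1 \<and> r\<^sub>v \<le> s - 1 \<and> r\<^sub>u + r\<^sub>v \<le> k - 1.
           real (r\<^sub>u + 1) * multinomial k [r\<^sub>u + 1, r\<^sub>v] * h_count (n - 2) (k - r\<^sub>u - r\<^sub>v - 1) s)"
proof
  have "finite (verts G)"
    using assms by (simp add: simple_graph_def)
  from card_lists_capped[OF this, of k "\<lambda>_. s"]
  show "real (card (verts (supertoken_graph k s G))) = h_count n k s"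
    using assms(2) by (simp add: supertoken_graph_def token_configs_def h_count_eq_coeff)
next
  obtain m where k: "k = Suc m"
    using assms(4) by (cases k) auto
  define E where "E = fps_exp_trunc (s - 1)"
  define H where "H = fps_exp_trunc s ^ (n - 2)"
  let ?R = "{(a, b). a \<le> s - 1 \<and> b \<le> s - 1 \<and> a + b \<le> m}"
  have "E $ t = 0" if "t \<notin> {..s - 1}" for t
    using that by (simp add: E_def fps_exp_trunc_def)
  then have "(E ^ 2 * H) $ m = (\<Sum>ts | length ts = 2 \<and> set ts \<subseteq> {..s - 1} \<and> sum_list ts \<le> m.
      prod_list (map (fps_nth E) ts) * H $ (m - sum_list ts))"
    by (rule fps_power_mult_nth)
  \<comment> \<open>Lists of length 2 are the pairs of token numbers at the two ends of the edge,
    the moving token excluded.\<close>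
  also have "{ts. length ts = 2 \<and> set ts \<subseteq> {..s - 1} \<and> sum_list ts \<le> m}
      = (\<lambda>(a, b). [a, b]) ` ?R"
    by (auto simp: length_Suc_conv numeral_2_eq_2 image_iff)
  also have "(\<Sum>ts\<in>(\<lambda>(a, b). [a, b]) ` ?R. prod_list (map (fps_nth E) ts) * H $ (m - sum_list ts))
      = (\<Sum>(a, b)\<in>?R. E $ a * E $ b * H $ (m - (a + b)))"
    by (subst sum.reindex) (auto simp: inj_on_def case_prod_beta)
  finally have "fact k * (E ^ 2 * H) $ m
      = (\<Sum>(a, b)\<in>?R. fact k * (E $ a * E $ b * H $ (m - (a + b))))"
    by (simp add: sum_distrib_left case_prod_beta)
  also have "\<dots> = (\<Sum>(a, b)\<in>?R. real (a + 1) * multinomial k [a + 1, b] *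
      h_count (n - 2) (k - a - b - 1) s)"
  proof (rule sum.cong, simp, clarify)
    fix a b
    assume ab: "a \<le> s - 1" "b \<le> s - 1" "a + b \<le> m"
    \<comment> \<open>The last block of the multinomial coefficient has the same size as the second
      argument of \<open>h_count\<close>, so their factorials cancel.\<close>
    have "k - (Suc a + b) = m - (a + b)" "k - a - b - 1 = m - (a + b)"
      using k by simp_all
    \<comment> \<open>Rewriting 1 / a! over (a + 1)! produces the factor \<open>a + 1\<close> and
      the entry \<open>a + 1\<close> of the multinomial coefficient.\<close>
    moreover have "E $ a = real (a + 1) / fact (a + 1)" "E $ b = 1 / fact b"
      using ab by (simp_all add: E_def fps_exp_trunc_def)
    ultimately show "fact k * (E $ a * E $ b * H $ (m - (a + b)))
      = real (a + 1) * multinomial k [a + 1, b] * h_count (n - 2) (k - a - b - 1) s"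
      by (simp add: multinomial_def h_count_eq_coeff H_def del: fact_Suc)
  qed
  finally show "real (card (edges (supertoken_graph k s G))) =
        real (card (edges G)) *
        (\<Sum>(r\<^sub>u, r\<^sub>v) | r\<^sub>u \<le> s - 1 \<and> r\<^sub>v \<le> s - 1 \<and> r\<^sub>u + r\<^sub>v \<le> k - 1.
           real (r\<^sub>u + 1) * multinomial k [r\<^sub>u + 1, r\<^sub>v] * h_count (n - 2) (k - r\<^sub>u - r\<^sub>v - 1) s)"
    using card_edges_supertoken_graph[OF assms(1), of s m] assms(2,3)
    by (simp add: k E_def H_def del: fact_Suc)
qed

end
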